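(* Let $0<\lambda<1$, $0<a<1$, and let $\{\mathbf{Q}(n)\}_{n\ge 0}=\{(Q_1(n),Q_2(n))\}_{n\ge0}$ be the discrete-time Markov chain on $\{(i,j): i,j\in\mathbb{Z}_{\ge 0}\}$ defined in the context. Let $(\mathbb{E}_x^{H},\mathbb{E}_y^{H})$ and $(\mathbb{E}_x^{V},\mathbb{E}_y^{V})$ denote its mean one-step jump vectors from states in $H=\{i>j>0\}$ and $V=\{j>i>0\}$, respectively. Then the chain is stable (i.e. ergodic / positive recurrent) if and only if $$\mathbb{E}_x^{H}<0,\qquad \mathbb{E}_y^{V}<0,\qquad \mathbb{E}_x^{H}+\mathbb{E}_y^{H}=\mathbb{E}_x^{V}+\mathbb{E}_y^{V}=\lambda-2a\bar a<0 .$$ Equivalently, the stability condition can be written as $$\rho:=\frac{\lambda(\bar a^{2}+a^{2})}{2\bar\lambda\,\bar a\,a}<1 .$$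
   Context: Notation: $\bar a=1-a$, $\bar\lambda=1-\lambda$. The chain models two relay queues: in each slot a packet arrives with probability $\lambda$ at the beginning of the slot and joins the shorter queue (each with probability $1/2$ in case of a tie); at the end of the slot each non-empty relay transmits independently with probability $a$; if exactly one relay transmits, one packet leaves that relay; if both transmit there is a collision and no packet leaves. Write $p_{i',j'}(i,j)=\mathbb{P}[\mathbf{Q}(n+1)=(i+i',j+j')\mid \mathbf{Q}(n)=(i,j)]$. The transition probabilities (all those not listed are $0$) are: (1) $(i,j)$ with $i>j>0$ (region $H$): $p_{0,1}=\lambda(\bar a^2+a^2)$, $p_{0,-1}=\bar\lambda a\bar a$, $p_{-1,0}=\bar\lambda a\bar a$, $p_{-1,1}=\lambda a\bar a$, $p_{0,0}=\bar\lambda(\bar a^2+a^2)+\lambda a\bar a$. (2) $(i,j)$ with $j>i>0$ (region $V$): $p_{1,0}=\lambda(\bar a^2+a^2)$, $p_{0,-1}=\bar\lambda a\bar a$, $p_{-1,0}=\bar\lambda a\bar a$, $p_{1,-1}=\lambda a\bar a$, $p_{0,0}=\bar\lambda(\bar a^2+a^2)+\lambda a\bar a$. (3) $(i,0)$ with $i>0$: $p_{0,1}=\lambda(\bar a^2+a^2)$, $p_{-1,0}=\bar\lambda a$, $p_{-1,1}=\lambda a\bar a$, $p_{0,0}=\bar\lambda\bar a+\lambda a\bar a$. (4) $(0,j)$ with $j>0$: $p_{1,0}=\lambda(\bar a^2+a^2)$, $p_{0,-1}=\bar\lambda a$, $p_{1,-1}=\lambda a\bar a$, $p_{0,0}=\bar\lambda\bar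 a+\lambda a\bar a$. (5) $(i,i)$ with $i>0$: $p_{1,0}=p_{0,1}=\tfrac12\lambda(\bar a^2+a^2)$, $p_{0,-1}=p_{-1,0}=\bar\lambda a\bar a$, $p_{1,-1}=p_{-1,1}=\tfrac12\lambda a\bar a$, $p_{0,0}=\bar\lambda(\bar a^2+a^2)+\lambda a\bar a$. (6) $(0,0)$: $p_{0,1}=p_{1,0}=\tfrac12\lambda\bar a$, $p_{0,0}=\bar\lambda+\lambda a$. *)

theory Defs
  imports "HOL-Probability.Probability"
begin

primrec n_step :: "('s \<Rightarrow> 's pmf) \<Rightarrow> nat \<Rightarrow> 's \<Rightarrow> 's pmf" where
  "n_step K 0 x = return_pmf x"
| "n_step K (Suc n) x = bind_pmf (K x) (n_step K n)"

definition irreducible_chain :: "('s \<Rightarrow> 's pmf) \<Rightarrow> bool" where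
  "irreducible_chain K \<longleftrightarrow> (\<forall>x y. \<exists>n. pmf (n_step K n x) y > 0)"

definition aperiodic_chain :: "('s \<Rightarrow> 's pmf) \<Rightarrow> bool" where
  "aperiodic_chain K \<longleftrightarrow> (\<forall>x. Gcd {n. n > 0 \<and> pmf (n_step K n x) x > 0} = 1)"

text \<open>
  The law on \<open>nat \<Rightarrow> 's\<close> of the chain \<open>(Q(n))\<close> with kernel \<open>K\<close> and \<open>Q(0) = x\<close>, obtained from the
  Ionescu-Tulcea theorem; \<open>Q(n)\<close> is the coordinate map \<open>\<lambda>\<omega>. \<omega> n\<close>. The lemma \<open>emeasure_chain_law\<close>
  below confirms that its finite-dimensional distributions are the intended ones.
\<close>

definition chain_step :: "('s \<Rightarrow> 's pmf) \<Rightarrow> 's \<Rightarrow> nat \<Rightarrow> (nat \<Rightarrow> 's) \<Rightarrow> 's measure" where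
  "chain_step K x n \<omega> = measure_pmf (case n of 0 \<Rightarrow> return_pmf x | Suc m \<Rightarrow> K (\<omega> m))"

definition chain_law :: "('s \<Rightarrow> 's pmf) \<Rightarrow> 's \<Rightarrow> (nat \<Rightarrow> 's) measure" where
  "chain_law K x =
     projective_family.lim UNIV (Ionescu_Tulcea.CI (chain_step K x) (\<lambda>_. count_space UNIV))
       (\<lambda>_. count_space UNIV)"

text \<open>The infimum is taken in \<open>enat\<close>, so it is \<open>\<infinity>\<close> if the path never returns.\<close>

definition return_time :: "'s \<Rightarrow> (nat \<Rightarrow> 's) \<Rightarrow> enat" where
  "return_time x \<omega> = Inf {enat n | n. n \<ge> 1 \<and> \<omega> n = x}"

definition positive_recurrent :: "('s \<Rightarrow> 's pmf) \<Rightarrow> bool" where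
  "positive_recurrent K \<longleftrightarrow>
     (\<forall>x. (\<integral>\<^sup>+\<omega>. ennreal_of_enat (return_time x \<omega>) \<partial>chain_law K x) < \<infinity>)"

definition ergodic_chain :: "('s \<Rightarrow> 's pmf) \<Rightarrow> bool" where
  "ergodic_chain K \<longleftrightarrow> irreducible_chain K \<and> aperiodic_chain K \<and> positive_recurrent K"

lemma Ionescu_Tulcea_chain_step: "Ionescu_Tulcea (chain_step K x) (\<lambda>_. count_space UNIV)"
proof (rule Ionescu_Tulcea.intro)
  fix i
  show "chain_step K x i \<in> measurable (PiM {0..<i} (\<lambda>_. count_space UNIV))
          (subprob_algebra (count_space UNIV))"
  proof (cases i)
    case 0
    then show ?thesis
      by (simp add: chain_step_def[abs_def] measure_pmf_in_subprob_algebra)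
  next
    case (Suc m)
    have "(\<lambda>\<omega>. \<omega> m) \<in> measurable (PiM {0..<i} (\<lambda>_. count_space UNIV)) (count_space (UNIV :: 'a set))"
      using Suc by (intro measurable_component_singleton) auto
    moreover have "(\<lambda>y. measure_pmf (K y)) \<in> measurable (count_space UNIV) (subprob_algebra (count_space UNIV))"
      by (simp add: measure_pmf_in_subprob_algebra)
    ultimately have "(\<lambda>\<omega>. measure_pmf (K (\<omega> m))) \<in> measurable (PiM {0..<i} (\<lambda>_. count_space UNIV))
          (subprob_algebra (count_space UNIV))"
      by (rule measurable_compose)
    then show ?thesis
      by (simp add: Suc chain_step_def[abs_def])
  qed
next
  fix i \<omega>
  show "prob_space (chain_step K x i \<omega>)"
    unfolding chain_step_def by (rule measure_pmf.prob_space_axioms)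
qed

lemma prob_space_chain_law: "prob_space (chain_law K x)"
proof -
  interpret IT: Ionescu_Tulcea "chain_step K x" "\<lambda>_. count_space UNIV"
    by (rule Ionescu_Tulcea_chain_step)
  have e: "emeasure IT.PF.lim (IT.PF.emb UNIV {} {\<lambda>_. undefined}) = emeasure (IT.CI {}) {\<lambda>_. undefined}"
    by (rule IT.lim) (auto simp: PiM_empty)
  interpret P: prob_space "IT.CI {}" by (rule IT.PF.prob_space_P) auto
  have "emeasure (IT.CI {}) {\<lambda>_. undefined} = 1"
    using P.emeasure_space_1 by (simp add: IT.CI_def space_PiM_empty)
  with e show ?thesis unfolding chain_law_def
    by (intro prob_spaceI) (simp add: prod_emb_def space_PiM_empty IT.PF.space_lim space_PiM restrict_def)
qed

lemma sets_chain_law: "sets (chain_law K x) = sets (PiM UNIV (\<lambda>_. count_space UNIV))"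
proof -
  interpret IT: Ionescu_Tulcea "chain_step K x" "\<lambda>_. count_space UNIV"
    by (rule Ionescu_Tulcea_chain_step)
  show ?thesis by (simp add: chain_law_def IT.PF.sets_lim)
qed

lemma measurable_return_time:
  "(\<lambda>\<omega>. ennreal_of_enat (return_time x \<omega>)) \<in> borel_measurable (chain_law K y)"
proof -
  have [measurable]: "(\<lambda>\<omega>. \<omega> n) \<in> measurable (chain_law K y) (count_space UNIV)" for n
    unfolding measurable_cong_sets[OF sets_chain_law refl]
    by (rule measurable_component_singleton) simp
  have "return_time x \<omega> = (INF n. if n \<ge> 1 \<and> \<omega> n = x then enat n else \<infinity>)" for \<omega> :: "nat \<Rightarrow> 'a"
    unfolding return_time_def
  proof (rule antisym)
    show "Inf {enat n |n. 1 \<le> n \<and> \<omega> n = x} \<le> (INF n. if n \<ge> 1 \<and> \<omega> n = x then enat n else \<infinity>)"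
      by (rule INF_greatest) (auto intro: Inf_lower)
    show "(INF n. if n \<ge> 1 \<and> \<omega> n = x then enat n else \<infinity>) \<le> Inf {enat n |n. 1 \<le> n \<and> \<omega> n = x}"
    proof (rule Inf_greatest, clarify)
      fix n assume "1 \<le> n" "x = \<omega> n"
      then show "(INF k. if k \<ge> 1 \<and> \<omega> k = \<omega> n then enat k else \<infinity>) \<le> enat n"
        by (intro INF_lower2[of n]) simp_all
    qed
  qed
  then show ?thesis
    by (simp only:) measurable
qed

lemma emeasure_chain_law:
  "emeasure (chain_law K x) {\<omega>. \<forall>k\<le>n. \<omega> k = s k} =
     ennreal (of_bool (s 0 = x) * (\<Prod>k<n. pmf (K (s k)) (s (Suc k))))"
proof -
  interpret IT: Ionescu_Tulcea "chain_step K x" "\<lambda>_. count_space UNIV"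
    by (rule Ionescu_Tulcea_chain_step)
  define A where "A m = PiE {0..<m} (\<lambda>k. {s k})" for m :: nat
  let ?M = "\<lambda>m::nat. PiM {0..<m} (\<lambda>_. count_space (UNIV :: 'a set))"
  let ?u = "\<lambda>_::nat. undefined :: 'a"
  have A: "A m \<in> sets (?M m)" for m
    unfolding A_def by (intro sets_PiM_I_finite) auto
  have u: "?u \<in> space (?M 0)" by (simp add: space_PiM)
  have step: "emeasure (IT.C 0 (Suc m) ?u) (A (Suc m)) =
      ennreal (case m of 0 \<Rightarrow> of_bool (s 0 = x) | Suc k \<Rightarrow> pmf (K (s k)) (s m)) *
      emeasure (IT.C 0 m ?u) (A m)" (is "_ = ?c * _") for m
  proof -
    have "emeasure (IT.C 0 (Suc m) ?u) (A (Suc m)) = (\<integral>\<^sup>+\<omega>. emeasure (IT.eP m \<omega>) (A (Suc m)) \<partial>IT.C 0 m ?u)"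
      using u IT.space_C[OF u, of m] A[of "Suc m"] IT.measurable_eP[of m]
      by (simp, subst emeasure_bind[where N="?M (Suc m)"])
         (auto simp: measurable_cong_sets[OF IT.sets_C[OF u] refl] space_PiM PiE_eq_empty_iff)
    also have "\<dots> = (\<integral>\<^sup>+\<omega>. ?c * indicator (A m) \<omega> \<partial>IT.C 0 m ?u)"
    proof (rule nn_integral_cong)
      fix \<omega> assume "\<omega> \<in> space (IT.C 0 m ?u)"
      then have w: "\<omega> \<in> space (?M m)" by (simp add: IT.space_C[OF u])
      then have ext: "\<omega> \<in> extensional {0..<m}" by (simp add: space_PiM PiE_def)
      have eq: "(\<lambda>y. fun_upd \<omega> m y) -` A (Suc m) = (if \<omega> \<in> A m then {s m} else {})"
        using ext unfolding A_def
        by (auto simp: PiE_iff less_Suc_eq extensional_def split: if_splits)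
      have "emeasure (IT.eP m \<omega>) (A (Suc m)) = emeasure (chain_step K x m \<omega>) (if \<omega> \<in> A m then {s m} else {})"
        using IT.emeasure_eP[OF w A[of "Suc m"]] by (simp only: eq) (simp add: eq)
      also have "\<dots> = ?c * indicator (A m) \<omega>"
      proof (cases "\<omega> \<in> A m")
        case True
        then have "k < m \<Longrightarrow> \<omega> k = s k" for k by (auto simp: A_def PiE_iff)
        with True show ?thesis
          by (auto simp: chain_step_def emeasure_pmf_single indicator_def split: nat.splits)
      qed simp
      finally show "emeasure (IT.eP m \<omega>) (A (Suc m)) = ?c * indicator (A m) \<omega>" .
    qed
    also have "\<dots> = ?c * emeasure (IT.C 0 m ?u) (A m)"
      using A[of m] by (subst nn_integral_cmult_indicator) (auto simp: IT.sets_C[OF u])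
    finally show ?thesis .
  qed
  have base: "emeasure (IT.C 0 0 ?u) (A 0) = 1"
    by (auto simp: A_def PiM_empty)
  have C: "emeasure (IT.C 0 (Suc n) ?u) (A (Suc n)) =
     ennreal (of_bool (s 0 = x) * (\<Prod>k<n. pmf (K (s k)) (s (Suc k))))" for n
  proof (induction n)
    case 0 then show ?case using step[of 0] base by simp
  next
    case (Suc n)
    show ?case unfolding step[of "Suc n"] Suc
      by (simp add: ennreal_mult[symmetric] prod_nonneg mult_ac)
  qed
  have e: "{\<omega>. \<forall>k\<le>n. \<omega> k = s k} = IT.PF.emb UNIV {0..<Suc n} (A (Suc n))"
    by (auto simp: prod_emb_def A_def space_PiM PiE_iff less_Suc_eq_le)
  have "emeasure (chain_law K x) {\<omega>. \<forall>k\<le>n. \<omega> k = s k} = emeasure (IT.CI {0..<Suc n}) (A (Suc n))"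
    unfolding e chain_law_def by (intro IT.lim A) simp
  also have "\<dots> = emeasure (IT.C 0 (Suc n) ?u) (IT.PF.emb {0..<Suc n} {0..<Suc n} (A (Suc n)))"
    by (intro IT.emeasure_CI A) simp
  also have "IT.PF.emb {0..<Suc n} {0..<Suc n} (A (Suc n)) = A (Suc n)"
    using sets.sets_into_space[OF A[of "Suc n"]] by (intro prod_emb_id) (simp add: space_PiM)
  finally show ?thesis by (simp only: C)
qed

type_synonym state = "nat \<times> nat"

text \<open>
  Each entry \<open>((i', j'), p)\<close> of the list is the probability \<open>p\<close> of the jump \<open>(i', j')\<close> from the given
  state; jumps that are not listed have probability \<open>0\<close>.
\<close>

definition jump_table :: "real \<Rightarrow> real \<Rightarrow> state \<Rightarrow> ((int \<times> int) \<times> real) list" where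
  "jump_table lam a = (\<lambda>(i, j).
     let lam' = 1 - lam; a' = 1 - a in
     if i > j \<and> j > 0 then
       [((0, 1), lam * (a'^2 + a^2)), ((0, -1), lam' * a * a'), ((-1, 0), lam' * a * a'),
        ((-1, 1), lam * a * a'), ((0, 0), lam' * (a'^2 + a^2) + lam * a * a')]
     else if j > i \<and> i > 0 then
       [((1, 0), lam * (a'^2 + a^2)), ((0, -1), lam' * a * a'), ((-1, 0), lam' * a * a'),
        ((1, -1), lam * a * a'), ((0, 0), lam' * (a'^2 + a^2) + lam * a * a')]
     else if i > 0 \<and> j = 0 then
       [((0, 1), lam * (a'^2 + a^2)), ((-1, 0), lam' * a), ((-1, 1), lam * a * a'),
        ((0, 0), lam' * a' + lam * a * a')]
     else if i = 0 \<and> j > 0 then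
       [((1, 0), lam * (a'^2 + a^2)), ((0, -1), lam' * a), ((1, -1), lam * a * a'),
        ((0, 0), lam' * a' + lam * a * a')]
     else if i = j \<and> i > 0 then
       [((1, 0), lam * (a'^2 + a^2) / 2), ((0, 1), lam * (a'^2 + a^2) / 2),
        ((0, -1), lam' * a * a'), ((-1, 0), lam' * a * a'),
        ((1, -1), lam * a * a' / 2), ((-1, 1), lam * a * a' / 2),
        ((0, 0), lam' * (a'^2 + a^2) + lam * a * a')]
     else
       [((0, 1), lam * a' / 2), ((1, 0), lam * a' / 2), ((0, 0), lam' + lam * a)])"

text \<open>
  The truncation in \<open>nat\<close> is never active: no listed jump leaves the quadrant. The table is a
  probability distribution whenever \<open>lam\<close> and \<open>a\<close> lie in \<open>[0, 1]\<close>, see \<open>pmf_of_list_wf_jump_table\<close>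
  and \<open>jump_table_quadrant\<close>.
\<close>

definition relay_kernel :: "real \<Rightarrow> real \<Rightarrow> state \<Rightarrow> state pmf" where
  "relay_kernel lam a = (\<lambda>(i, j).
     map_pmf (\<lambda>(i', j'). (nat (int i + i'), nat (int j + j'))) (pmf_of_list (jump_table lam a (i, j))))"

lemma pmf_of_list_wf_jump_table:
  assumes "0 \<le> lam" "lam \<le> 1" "0 \<le> a" "a \<le> 1"
  shows "pmf_of_list_wf (jump_table lam a s)"
proof (rule pmf_of_list_wfI)
  obtain i j where s: "s = (i, j)" by (cases s)
  have q: "0 \<le> (1 - a)^2 + a^2" by simp
  have b: "0 \<le> lam * ((1 - a)^2 + a^2)" "0 \<le> (1 - lam) * ((1 - a)^2 + a^2)"
    "0 \<le> lam * a" "0 \<le> lam * (1 - a)" "0 \<le> (1 - lam) * a" "0 \<le> (1 - lam) * (1 - a)"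
    "0 \<le> lam * a * (1 - a)" "0 \<le> (1 - lam) * a * (1 - a)" "0 \<le> 1 - lam"
    using assms q by (auto intro: mult_nonneg_nonneg)
  have "list_all (\<lambda>z. 0 \<le> snd z) (jump_table lam a s)"
    unfolding s jump_table_def Let_def prod.case
    by (simp only: list.pred_inject snd_conv split: if_split)
       (intro conjI impI TrueI; use b in linarith)
  then show "0 \<le> p" if "p \<in> set (map snd (jump_table lam a s))" for p
    using that by (auto simp: list_all_iff)
  show "sum_list (map snd (jump_table lam a s)) = 1"
    unfolding s jump_table_def Let_def prod.case
    by (simp only: list.map sum_list_simps snd_conv split: if_split)
       (intro conjI impI; simp add: power2_eq_square algebra_simps)
qed

lemma jump_table_quadrant:
  assumes "((i', j'), p) \<in> set (jump_table lam a (i, j))"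
  shows "int i + i' \<ge> 0" "int j + j' \<ge> 0"
  using assms by (auto simp: jump_table_def Let_def split: if_splits)

lemma pmf_relay_kernel:
  assumes "0 \<le> lam" "lam \<le> 1" "0 \<le> a" "a \<le> 1"
  shows "pmf (relay_kernel lam a (i, j)) (k, l) =
    sum_list (map snd (filter (\<lambda>z. fst z = (int k - int i, int l - int j)) (jump_table lam a (i, j))))"
proof -
  let ?t = "jump_table lam a (i, j)"
  let ?f = "\<lambda>(i', j'). (nat (int i + i'), nat (int j + j'))"
  note wf = pmf_of_list_wf_jump_table[OF assms, of "(i, j)"]
  have nonneg: "fst z \<in> {d. int i + fst d \<ge> 0 \<and> int j + snd d \<ge> 0}" if "z \<in> set ?t" for z
    using jump_table_quadrant[of "fst (fst z)" "snd (fst z)" "snd z" lam a i j] that by simp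
  have "pmf (relay_kernel lam a (i, j)) (k, l) = measure (pmf_of_list ?t) (?f -` {(k, l)})"
    by (simp add: relay_kernel_def pmf_map)
  also have "\<dots> = sum_list (map snd (filter (\<lambda>z. fst z \<in> ?f -` {(k, l)}) ?t))"
    by (rule measure_pmf_of_list[OF wf])
  also have "filter (\<lambda>z. fst z \<in> ?f -` {(k, l)}) ?t =
      filter (\<lambda>z. fst z = (int k - int i, int l - int j)) ?t"
    using nonneg by (intro filter_cong refl) (auto simp: prod_eq_iff split_beta)
  finally show ?thesis .
qed

definition region_H :: "state set" where
  "region_H = {(i, j). i > j \<and> j > 0}"

definition region_V :: "state set" where
  "region_V = {(i, j). j > i \<and> i > 0}"

definition mean_jump :: "(state \<Rightarrow> state pmf) \<Rightarrow> state \<Rightarrow> real \<times> real" where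
  "mean_jump K s =
     (measure_pmf.expectation (K s) (\<lambda>t. real (fst t) - real (fst s)),
      measure_pmf.expectation (K s) (\<lambda>t. real (snd t) - real (snd s)))"

end

theory Submission
  imports Defs "HOL-Real_Asymp.Real_Asymp"
begin

text \<open>
  With \<open>c = a * (1 - a)\<close>, the conditions on the mean jumps and on \<open>\<rho>\<close> both say \<open>lam < 2 * c\<close>. If this
  holds, \<open>i\<^sup>2 + j\<^sup>2\<close> satisfies Foster's criterion. Otherwise \<open>i + j\<close> plus bounded corrections for the
  axes and the diagonal is, outside a finite set, a submartingale with bounded increments.
  Truncated from below by a large constant it becomes one everywhere. Positive recurrence would
  force the truncated function to vanish, but it is unbounded.
\<close>

section \<open>Return times and avoidance probabilities\<close>

text \<open>Only one inequality of the drift condition has content: in \<open>region_H\<close> and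
  \<open>region_V\<close> the longer queue loses a packet with probability \<open>c\<close>, with or
  without an arrival. So E_x^H = E_y^V = -c, and both sums equal \<open>lam - 2 * c\<close>. The
  boundary case \<open>lam = 2 * c\<close> shapes the second half. The axis correction is geometric
  with ratio 1/2 for a reason: off the axes and the diagonal, arrivals alone raise
  \<open>min i j\<close> with probability \<open>p\<close> and departures alone lower it with
  probability \<open>q\<close>, and \<open>2 * q \<le> p\<close>. These moves therefore do not
  increase the mean of \<open>(1 / 2) ^ min i j\<close>.\<close>

primrec path_pmf :: "('s \<Rightarrow> 's pmf) \<Rightarrow> nat \<Rightarrow> 's \<Rightarrow> 's list pmf" where
  "path_pmf K 0 x = return_pmf [x]"
| "path_pmf K (Suc n) x = map_pmf ((#) x) (bind_pmf (K x) (path_pmf K n))"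

text \<open>Only the states after \<open>y\<close> are tested against \<open>x\<close>: from
  \<open>y = x\<close> this is the tail of the return time, from elsewhere that of the passage
  time.\<close>

primrec avoid_prob :: "('s \<Rightarrow> 's pmf) \<Rightarrow> 's \<Rightarrow> nat \<Rightarrow> 's \<Rightarrow> ennreal" where
  "avoid_prob K x 0 y = 1"
| "avoid_prob K x (Suc n) y = (\<integral>\<^sup>+z. indicator (- {x}) z * avoid_prob K x n z \<partial>K y)"

lemma set_path_pmf: "l \<in> set_pmf (path_pmf K n x) \<Longrightarrow> length l = Suc n \<and> hd l = x"
  by (induction n arbitrary: l x) auto

lemma pmf_path_pmf:
  "pmf (path_pmf K n x) (map s [0..<Suc n]) =
     of_bool (s 0 = x) * (\<Prod>k<n. pmf (K (s k)) (s (Suc k)))"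
proof (induction n arbitrary: s x)
  case 0
  then show ?case by (simp add: pmf_return)
next
  case (Suc n)
  have split: "map s [0..<Suc (Suc n)] = s 0 # map (s \<circ> Suc) [0..<Suc n]"
    by (simp add: upt_conv_Cons map_Suc_upt[symmetric] del: upt_Suc)
  have "pmf (map_pmf ((#) x) M) (b # l) = of_bool (b = x) * pmf M l" for b l and M :: "'a list pmf"
  proof (cases "b = x")
    case True
    then show ?thesis by (simp add: pmf_map_inj')
  next
    case False
    then have "b # l \<notin> set_pmf (map_pmf ((#) x) M)" by auto
    with False show ?thesis by (simp add: pmf_eq_0_set_pmf)
  qed
  moreover have "pmf (bind_pmf (K x) (path_pmf K n)) (map (s \<circ> Suc) [0..<Suc n]) =
      pmf (K x) (s 1) * (\<Prod>k<n. pmf (K (s (Suc k))) (s (Suc (Suc k))))"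
  proof -
    \<comment> \<open>A path from \<open>y\<close> begins with \<open>y\<close>, so only the
      successor \<open>s 1\<close> contributes to the mixture.\<close>
    have "pmf (bind_pmf (K x) (path_pmf K n)) (map (s \<circ> Suc) [0..<Suc n]) =
        (\<integral>y. (\<Prod>k<n. pmf (K (s (Suc k))) (s (Suc (Suc k)))) * indicator {s 1} y \<partial>K x)"
      unfolding pmf_bind Suc by (intro Bochner_Integration.integral_cong) (auto simp: indicator_def)
    then show ?thesis by (simp add: measure_pmf_single)
  qed
  ultimately show ?case
    unfolding split path_pmf.simps prod.lessThan_Suc_shift by (simp del: upt_Suc)
qed

text \<open>Passage from the infinite product to discrete laws: lists over a countable type are
  countable, so it suffices to compare singletons, whose preimages are cylinders evaluated by
  \<open>emeasure_chain_law\<close>.\<close>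

lemma
  fixes K :: "'s :: countable \<Rightarrow> 's pmf"
  shows measurable_initial_segment:
      "(\<lambda>\<omega>. map \<omega> [0..<Suc n]) \<in> measurable (chain_law K x) (count_space UNIV)"
    and distr_initial_segment:
      "distr (chain_law K x) (count_space UNIV) (\<lambda>\<omega>. map \<omega> [0..<Suc n]) =
        measure_pmf (path_pmf K n x)"
proof -
  have sp: "space (chain_law K x) = UNIV"
    using sets_eq_imp_space_eq[OF sets_chain_law[of K x]] by (simp add: space_PiM)
  have comp[measurable]: "(\<lambda>\<omega>. \<omega> k) \<in> measurable (chain_law K x) (count_space UNIV)" for k
    unfolding measurable_cong_sets[OF sets_chain_law refl]
    by (rule measurable_component_singleton) simp
  have pre: "(\<lambda>\<omega>. map \<omega> [0..<Suc n]) -` {l} =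
      (if length l = Suc n then {\<omega>. \<forall>k\<le>n. \<omega> k = l ! k} else {})" for l :: "'s list"
  proof -
    have "map \<omega> [0..<Suc n] = l \<longleftrightarrow> length l = Suc n \<and> (\<forall>k\<le>n. \<omega> k = l ! k)" for \<omega> :: "nat \<Rightarrow> 's"
      unfolding list_eq_iff_nth_eq by (auto simp: less_Suc_eq_le nth_append le_less)
    then show ?thesis by (auto simp del: upt_Suc)
  qed
  have "{\<omega>. \<forall>k\<le>n. \<omega> k = l ! k} \<in> sets (chain_law K x)" for l
  proof -
    have "{\<omega> \<in> space (chain_law K x). \<forall>k\<le>n. \<omega> k = l ! k} \<in> sets (chain_law K x)" by measurable
    then show ?thesis by (simp add: sp)
  qed
  then show meas: "(\<lambda>\<omega>. map \<omega> [0..<Suc n]) \<in> measurable (chain_law K x) (count_space UNIV)"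
    by (subst measurable_count_space_eq2_countable) (auto simp: pre sp simp del: upt_Suc)
  show "distr (chain_law K x) (count_space UNIV) (\<lambda>\<omega>. map \<omega> [0..<Suc n]) =
        measure_pmf (path_pmf K n x)"
  proof (rule measure_eqI_countable[where A = UNIV])
    fix l :: "'s list"
    show "emeasure (distr (chain_law K x) (count_space UNIV) (\<lambda>\<omega>. map \<omega> [0..<Suc n])) {l} =
      emeasure (path_pmf K n x) {l}"
    proof (cases "length l = Suc n")
      case True
      then have l: "l = map ((!) l) [0..<Suc n]" by (metis map_nth)
      have "emeasure (path_pmf K n x) {l} =
          ennreal (of_bool (l ! 0 = x) * (\<Prod>k<n. pmf (K (l ! k)) (l ! Suc k)))"
        unfolding emeasure_pmf_single by (subst l) (simp only: pmf_path_pmf)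
      then show ?thesis
        using True emeasure_chain_law[of K x n "(!) l"]
        by (simp add: emeasure_distr[OF meas] sp pre del: upt_Suc)
    next
      case False
      then have "l \<notin> set_pmf (path_pmf K n x)" by (auto dest: set_path_pmf)
      with False show ?thesis
        by (simp add: emeasure_distr[OF meas] sp pre emeasure_pmf_single set_pmf_iff del: upt_Suc)
    qed
  qed auto
qed

lemma emeasure_path_pmf_avoid:
  "emeasure (path_pmf K n y) {l. x \<notin> set (tl l)} = avoid_prob K x n y"
proof (induction n arbitrary: y)
  case 0
  then show ?case by simp
next
  case (Suc n)
  \<comment> \<open>\<open>tl\<close> drops the starting state, but the new head \<open>z\<close>
    must itself differ from \<open>x\<close>; this is the indicator in the recursion.\<close>
  have "emeasure (path_pmf K n z) {l. x \<notin> set l} = indicator (- {x}) z * avoid_prob K x n z" for z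
  proof -
    have "emeasure (path_pmf K n z) {l. x \<notin> set l} =
        emeasure (path_pmf K n z) (if z = x then {} else {l. x \<notin> set (tl l)})"
    proof (rule emeasure_eq_AE)
      show "AE l in path_pmf K n z. l \<in> {l. x \<notin> set l} \<longleftrightarrow>
          l \<in> (if z = x then {} else {l. x \<notin> set (tl l)})"
      proof (rule AE_pmfI)
        fix l assume "l \<in> set_pmf (path_pmf K n z)"
        then have "l = z # tl l" using set_path_pmf[of l K n z] by (cases l) auto
        then have "set l = insert z (set (tl l))" by (metis list.simps(15))
        then show "l \<in> {l. x \<notin> set l} \<longleftrightarrow> l \<in> (if z = x then {} else {l. x \<notin> set (tl l)})"
          by auto
      qed
    qed auto
    then show ?thesis by (simp add: Suc indicator_def)
  qed
  then show ?case
    by (simp add: emeasure_bind_pmf vimage_def)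
qed

lemma less_return_time_iff: "enat n < return_time x \<omega> \<longleftrightarrow> (\<forall>k\<in>{1..n}. \<omega> k \<noteq> x)"
proof
  assume L: "enat n < return_time x \<omega>"
  show "\<forall>k\<in>{1..n}. \<omega> k \<noteq> x"
  proof (intro ballI notI)
    fix k assume "k \<in> {1..n}" "\<omega> k = x"
    then have "return_time x \<omega> \<le> enat k" unfolding return_time_def by (intro Inf_lower) auto
    also have "\<dots> \<le> enat n" using \<open>k \<in> {1..n}\<close> by simp
    finally show False using L by simp
  qed
next
  assume R: "\<forall>k\<in>{1..n}. \<omega> k \<noteq> x"
  have "enat (Suc n) \<le> return_time x \<omega>"
    unfolding return_time_def
  proof (rule Inf_greatest, clarify)
    fix k assume "1 \<le> k" "x = \<omega> k"
    with R show "enat (Suc n) \<le> enat k" by (auto simp: not_less_eq_eq[symmetric])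
  qed
  then show "enat n < return_time x \<omega>" by (simp add: Suc_ile_eq)
qed

text \<open>Tail-sum formula; whether the return time exceeds \<open>n\<close> depends on the first
  \<open>n + 1\<close> states only. From here on path space is no longer needed.\<close>

lemma nn_integral_return_time:
  fixes K :: "'s :: countable \<Rightarrow> 's pmf"
  shows "(\<integral>\<^sup>+\<omega>. ennreal_of_enat (return_time x \<omega>) \<partial>chain_law K y) = (\<Sum>n. avoid_prob K x n y)"
proof -
  have sp: "space (chain_law K y) = UNIV"
    using sets_eq_imp_space_eq[OF sets_chain_law[of K y]] by (simp add: space_PiM)
  have tl: "set (tl (map \<omega> [0..<Suc n])) = \<omega> ` {1..n}" for n and \<omega> :: "nat \<Rightarrow> 's"
    by (simp add: map_tl[symmetric] tl_upt atLeastLessThanSuc_atLeastAtMost del: upt_Suc)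
  have seg: "{\<omega>. enat n < return_time x \<omega>} =
      (\<lambda>\<omega>. map \<omega> [0..<Suc n]) -` {l. x \<notin> set (tl l)} \<inter> space (chain_law K y)" for n
    by (auto simp: less_return_time_iff sp tl simp del: upt_Suc)
  have em: "emeasure (chain_law K y) {\<omega>. enat n < return_time x \<omega>} = avoid_prob K x n y" for n
    unfolding seg emeasure_path_pmf_avoid[symmetric] distr_initial_segment[symmetric]
    by (rule emeasure_distr[symmetric, OF measurable_initial_segment]) simp
  have "return_time x \<in> measurable (chain_law K y) (count_space UNIV)"
  proof (subst measurable_count_space_eq2_countable, intro conjI ballI)
    fix e
    have "return_time x -` {e} = (\<lambda>\<omega>. ennreal_of_enat (return_time x \<omega>)) -` {ennreal_of_enat e}"
      by auto
    then show "return_time x -` {e} \<inter> space (chain_law K y) \<in> sets (chain_law K y)"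
      using measurable_sets[OF measurable_return_time, of "{ennreal_of_enat e}" x K y] by simp
  qed simp
  then have "(\<integral>\<^sup>+\<omega>. ennreal_of_enat (return_time x \<omega>) \<partial>chain_law K y) =
      (\<Sum>n. emeasure (chain_law K y) {\<omega> \<in> space (chain_law K y). enat n < return_time x \<omega>})"
    by (rule nn_integral_enat_function)
  then show ?thesis by (simp add: sp em)
qed

section \<open>Foster's criterion and bounded submartingales\<close>

lemma avoid_prob_le_1: "avoid_prob K x n y \<le> 1"
proof (induction n arbitrary: y)
  case (Suc n)
  have "avoid_prob K x (Suc n) y \<le> (\<integral>\<^sup>+z. 1 \<partial>K y)"
    unfolding avoid_prob.simps using Suc by (intro nn_integral_mono) (auto simp: indicator_def)
  then show ?case by simp
qed simp

lemma avoid_prob_antimono: "m \<le> n \<Longrightarrow> avoid_prob K x n y \<le> avoid_prob K x m y"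
proof (rule lift_Suc_antimono_le[where f = "\<lambda>n. avoid_prob K x n y"])
  show "avoid_prob K x (Suc n) y \<le> avoid_prob K x n y" for n
  proof (induction n arbitrary: y)
    case 0
    then show ?case using avoid_prob_le_1[of K x 1 y] by simp
  next
    case (Suc n)
    then show ?case by (auto intro!: nn_integral_mono mult_left_mono)
  qed
qed

text \<open>First-step analysis of the truncated passage time \<open>min \<tau> n\<close>.\<close>

lemma sum_avoid_prob_step:
  "(\<Sum>k<Suc n. avoid_prob K x k y) =
     1 + (\<integral>\<^sup>+z. indicator (- {x}) z * (\<Sum>k<n. avoid_prob K x k z) \<partial>K y)"
  unfolding sum.lessThan_Suc_shift sum_distrib_left avoid_prob.simps
  by (subst nn_integral_sum) auto

lemma suminf_avoid_prob_step:
  "(\<Sum>k. avoid_prob K x k y) =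
     1 + (\<integral>\<^sup>+z. indicator (- {x}) z * (\<Sum>k. avoid_prob K x k z) \<partial>K y)"
proof -
  have "(\<Sum>k. avoid_prob K x k y) = avoid_prob K x 0 y + (\<Sum>k. avoid_prob K x (Suc k) y)"
    using suminf_offset[of "\<lambda>k. avoid_prob K x k y" 1] by simp
  also have "(\<Sum>k. avoid_prob K x (Suc k) y) =
      (\<integral>\<^sup>+z. indicator (- {x}) z * (\<Sum>k. avoid_prob K x k z) \<partial>K y)"
    by (simp add: nn_integral_suminf[symmetric])
  finally show ?thesis by simp
qed

text \<open>The mean passage time is the least nonnegative solution of the first-step equation, so
  every supersolution dominates it; the induction runs over truncated passage times.\<close>

lemma suminf_avoid_prob_le:
  fixes K :: "'s \<Rightarrow> 's pmf"
  assumes V: "\<And>y. 1 + (\<integral>\<^sup>+z. indicator (- {x}) z * V z \<partial>K y) \<le> V y"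
  shows "(\<Sum>k. avoid_prob K x k y) \<le> V y"
proof -
  have "(\<Sum>k<n. avoid_prob K x k y) \<le> V y" for n
  proof (induction n arbitrary: y)
    case (Suc n)
    have "(\<Sum>k<Suc n. avoid_prob K x k y) \<le> 1 + (\<integral>\<^sup>+z. indicator (- {x}) z * V z \<partial>K y)"
      unfolding sum_avoid_prob_step using Suc
      by (intro add_left_mono nn_integral_mono) (auto simp: indicator_def)
    also have "\<dots> \<le> V y" by (rule V)
    finally show ?case .
  qed simp
  then show ?thesis by (intro suminf_le_const) auto
qed

lemma set_pmf_n_step_avoid_prob:
  assumes "x \<in> set_pmf (n_step K n y)" "n > 0"
  shows "avoid_prob K x n y < 1"
  using assms
proof (induction n arbitrary: y)
  case (Suc n)
  then obtain z where z: "z \<in> set_pmf (K y)" "x \<in> set_pmf (n_step K n z)" by auto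
  let ?g = "\<lambda>z. indicator (- {x}) z * avoid_prob K x n z"
  have le: "?g w \<le> 1" for w using avoid_prob_le_1[of K x n w] by (auto simp: indicator_def)
  have lt: "?g z < 1"
  \<comment> \<open>For \<open>n = 0\<close>, membership in \<open>n_step K 0 z\<close> forces
    \<open>z = x\<close>; in both cases the indicator vanishes.\<close>
  proof (cases "z = x \<or> n = 0")
    case True
    with z show ?thesis by auto
  next
    case False
    with Suc.IH[OF z(2)] show ?thesis by (auto simp: indicator_def)
  qed
  have "(\<integral>\<^sup>+w. ?g w \<partial>K y) < (\<integral>\<^sup>+w. 1 \<partial>K y)"
  proof (rule nn_integral_less)
    show "(\<integral>\<^sup>+w. ?g w \<partial>K y) \<noteq> \<infinity>"
      using nn_integral_mono[of "K y" ?g "\<lambda>_. 1"] le by (auto simp: top_unique)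
    show "\<not> (AE w in K y. 1 \<le> ?g w)"
      using lt z(1) by (auto simp: AE_measure_pmf_iff not_le intro!: bexI[of _ z])
  qed (use le in auto)
  then show ?case by simp
qed simp

lemma irreducible_chainI:
  assumes "\<And>x y. (x, y) \<in> {(x, y). y \<in> set_pmf (K x)}\<^sup>*"
  shows "irreducible_chain K"
  unfolding irreducible_chain_def
proof (intro allI)
  fix x y
  from assms[of x y] have "\<exists>n. y \<in> set_pmf (n_step K n x)"
  proof (induction rule: converse_rtrancl_induct)
    case base
    show ?case by (rule exI[of _ 0]) simp
  next
    case (step u v)
    then obtain n where "y \<in> set_pmf (n_step K n v)" by blast
    with step(1) have "y \<in> set_pmf (n_step K (Suc n) u)" by auto
    then show ?case by blast
  qed
  then show "\<exists>n. pmf (n_step K n x) y > 0" by (auto intro: pmf_positive)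
qed

text \<open>\<open>irreducible_chain\<close> admits time 0, which says nothing when
  \<open>y = x\<close>; one preliminary step makes the time positive.\<close>

lemma irreducible_chain_hits:
  assumes "irreducible_chain K"
  shows "\<exists>n>0. x \<in> set_pmf (n_step K n y)"
proof -
  obtain z where z: "z \<in> set_pmf (K y)" using set_pmf_not_empty by fast
  obtain n where "pmf (n_step K n z) x > 0" using assms unfolding irreducible_chain_def by blast
  then have "x \<in> set_pmf (n_step K (Suc n) y)"
    using z by (auto intro!: bexI[of _ z] simp: set_pmf_iff[of x])
  then show ?thesis by blast
qed

text \<open>
  Let \<open>u\<close> be the mean of \<open>min \<tau> N\<close>, where \<open>\<tau>\<close> is the passage time to \<open>x\<close>. Its drift is never positive
  and, by irreducibility, is bounded away from \<open>0\<close> on \<open>A\<close> for large \<open>N\<close>. So \<open>V + C * u\<close> has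
  drift at most \<open>-1\<close> on \<open>A\<close> as well and therefore dominates the mean of \<open>\<tau>\<close>.
\<close>

theorem foster_positive_recurrent:
  fixes K :: "'s :: countable \<Rightarrow> 's pmf" and V :: "'s \<Rightarrow> ennreal"
  assumes irr: "irreducible_chain K" and A: "finite A"
    and V: "\<And>y. V y < \<infinity>" and b: "b < \<infinity>"
    and drift: "\<And>y. 1 + (\<integral>\<^sup>+z. V z \<partial>K y) \<le> V y + b * indicator A y"
  shows "positive_recurrent K"
  unfolding positive_recurrent_def nn_integral_return_time
proof
  fix x
  have "\<exists>N. \<forall>y\<in>A. avoid_prob K x N y < 1"
  proof -
    from irreducible_chain_hits[OF irr] obtain m
      where m: "m y > 0" "x \<in> set_pmf (n_step K (m y) y)" for y by metis
    have "avoid_prob K x (Max (m ` A)) y < 1" if "y \<in> A" for y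
      using avoid_prob_antimono[of "m y" "Max (m ` A)" K x y] set_pmf_n_step_avoid_prob[OF m(2,1)]
        A that by (meson Max_ge finite_imageI imageI le_less_trans)
    then show ?thesis by blast
  qed
  then obtain N where N: "\<And>y. y \<in> A \<Longrightarrow> avoid_prob K x N y < 1" by blast
  define u where "u y = (\<Sum>k<N. avoid_prob K x k y)" for y
  \<comment> \<open>The inserted \<open>0\<close> covers an empty \<open>A\<close>.\<close>
  define q where "q = Max (insert 0 (avoid_prob K x N ` A))"
  have q: "q < 1" unfolding q_def using N A by (subst Max_less_iff) auto
  have qA: "y \<in> A \<Longrightarrow> avoid_prob K x N y \<le> q" for y unfolding q_def using A by simp
  define \<delta> where "\<delta> = 1 - q"
  have \<delta>: "\<delta> > 0" "\<delta> < \<infinity>" "\<delta> + q = 1"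
    using q le_less_trans[OF diff_le_self_ennreal[of 1 q] ennreal_one_less_top]
    by (auto simp: \<delta>_def diff_gr0_ennreal diff_add_cancel_ennreal less_imp_le)
  have u_fin: "u y < \<infinity>" for y
    unfolding u_def using avoid_prob_le_1[of K x] 
    by (simp add: ennreal_sum_less_top le_less_trans[OF _ ennreal_one_less_top])
  have u_step: "(\<integral>\<^sup>+z. indicator (- {x}) z * u z \<partial>K y) + \<delta> * indicator A y \<le> u y" for y
  proof -
    \<comment> \<open>The drift of \<open>u\<close>, killed at \<open>x\<close>, is thus
      \<open>avoid_prob K x N y - 1\<close>. Below, \<open>1\<close> is split as
      \<open>\<delta> + q\<close> and \<open>q\<close> is cancelled, which avoids subtraction in
      \<open>ennreal\<close>.\<close>
    have *: "1 + (\<integral>\<^sup>+z. indicator (- {x}) z * u z \<partial>K y) = u y + avoid_prob K x N y"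
      unfolding u_def using sum_avoid_prob_step[of K x y N] by simp
    show ?thesis
    proof (cases "y \<in> A")
      case True
      have "q + ((\<integral>\<^sup>+z. indicator (- {x}) z * u z \<partial>K y) + \<delta>) = u y + avoid_prob K x N y"
        unfolding *[symmetric] \<delta>(3)[symmetric] by (simp add: ac_simps)
      also have "\<dots> \<le> q + u y" using qA[OF True] by (simp add: add.commute add_mono)
      finally show ?thesis using q True by (auto simp: ennreal_add_left_cancel_le)
    next
      case False
      have "1 + (\<integral>\<^sup>+z. indicator (- {x}) z * u z \<partial>K y) \<le> 1 + u y"
        unfolding * using avoid_prob_le_1[of K x N y] by (simp add: add.commute add_mono)
      then show ?thesis using False by (auto simp: ennreal_add_left_cancel_le)
    qed
  qed
  \<comment> \<open>Then \<open>C * \<delta> = b\<close>: on \<open>A\<close> the decrease of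
    \<open>C * u\<close> pays for the excess \<open>b\<close>.\<close>
  define C where "C = b / \<delta>"
  have C: "C * \<delta> = b" "C < \<infinity>"
    using \<delta>(1,2) b
    by (auto simp: C_def ennreal_divide_times less_top[symmetric] ennreal_divide_eq_top_iff)
  define W where "W y = V y + C * u y" for y
  have "1 + (\<integral>\<^sup>+z. indicator (- {x}) z * W z \<partial>K y) \<le> W y" for y
  proof -
    let ?I = "\<integral>\<^sup>+z. indicator (- {x}) z * u z \<partial>K y"
    have "(\<integral>\<^sup>+z. indicator (- {x}) z * W z \<partial>K y) \<le>
        (\<integral>\<^sup>+z. V z + C * (indicator (- {x}) z * u z) \<partial>K y)"
      unfolding W_def by (intro nn_integral_mono) (auto simp: indicator_def)
    also have "\<dots> = (\<integral>\<^sup>+z. V z \<partial>K y) + C * ?I"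
      by (simp add: nn_integral_add nn_integral_cmult)
    finally have "1 + (\<integral>\<^sup>+z. indicator (- {x}) z * W z \<partial>K y) \<le>
        (1 + (\<integral>\<^sup>+z. V z \<partial>K y)) + C * ?I"
      by (simp add: add.assoc add_left_mono)
    also have "\<dots> \<le> V y + C * \<delta> * indicator A y + C * ?I"
      using drift[of y] by (simp add: C add_right_mono)
    also have "\<dots> = V y + C * (?I + \<delta> * indicator A y)"
      by (simp add: algebra_simps)
    also have "\<dots> \<le> W y"
      unfolding W_def by (intro add_left_mono mult_left_mono u_step) simp
    finally show ?thesis .
  qed
  then have "(\<Sum>k. avoid_prob K x k x) \<le> W x" by (rule suminf_avoid_prob_le)
  also have "W x < \<infinity>" using V u_fin C by (simp add: W_def ennreal_mult_less_top)
  finally show "(\<Sum>k. avoid_prob K x k x) < \<infinity>" .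
qed

text \<open>Positive recurrence bounds the mean only from \<open>x\<close> itself. The first-step
  equation passes finiteness to every successor, which has positive weight, and irreducibility
  spreads it to all states.\<close>

lemma suminf_avoid_prob_finite:
  fixes K :: "'s :: countable \<Rightarrow> 's pmf"
  assumes irr: "irreducible_chain K" and pos: "positive_recurrent K"
  shows "(\<Sum>k. avoid_prob K x k y) < \<infinity>"
proof -
  define h where "h y = (\<Sum>k. avoid_prob K x k y)" for y
  have hx: "h x < \<infinity>"
    using pos unfolding positive_recurrent_def nn_integral_return_time h_def by blast
  have step: "h z < \<infinity>" if "h y < \<infinity>" "z \<in> set_pmf (K y)" for y z
  proof (cases "z = x")
    case False
    have "h y = 1 + (\<integral>\<^sup>+z. indicator (- {x}) z * h z \<partial>K y)"
      unfolding h_def by (rule suminf_avoid_prob_step)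
    with that(1) have "(\<integral>\<^sup>+z. indicator (- {x}) z * h z \<partial>K y) \<noteq> \<infinity>"
      by auto
    then have "AE z in K y. indicator (- {x}) z * h z \<noteq> \<infinity>"
      by (intro nn_integral_noteq_infinite) auto
    with that(2) have "indicator (- {x}) z * h z \<noteq> \<infinity>" by (auto simp: AE_measure_pmf_iff)
    with False show ?thesis by (simp add: less_top)
  qed (use hx in simp)
  have "h z < \<infinity>" if "h y < \<infinity>" "z \<in> set_pmf (n_step K n y)" for n y z
    using that
  proof (induction n arbitrary: y)
    case (Suc n)
    then show ?case using step[of y] by auto
  qed simp
  moreover obtain n where "y \<in> set_pmf (n_step K n x)"
    using irreducible_chain_hits[OF irr] by blast
  ultimately have "h y < \<infinity>" using hx by blast
  then show ?thesis by (simp add: h_def)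
qed

text \<open>
  Bounded increments give \<open>g \<le> D * h\<close>, where \<open>h\<close> is the mean passage time to \<open>x\<close>. Iterating the
  submartingale inequality along paths that avoid \<open>x\<close> bounds \<open>g y\<close> by \<open>D\<close> times the tails
  of the convergent series for \<open>h y\<close>.
\<close>

theorem bounded_submartingale_zero:
  fixes K :: "'s :: countable \<Rightarrow> 's pmf" and g :: "'s \<Rightarrow> real"
  assumes irr: "irreducible_chain K" and pos: "positive_recurrent K"
    and g: "\<And>y. g y \<ge> 0" "g x = 0"
    and incr: "\<And>y z. z \<in> set_pmf (K y) \<Longrightarrow> g y - g z \<le> D"
    and sub: "\<And>y. ennreal (g y) \<le> (\<integral>\<^sup>+z. ennreal (g z) \<partial>K y)"
  shows "g y = 0"
proof -
  define E where "E = max D 1"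
  have E: "E > 0" "\<And>y z. z \<in> set_pmf (K y) \<Longrightarrow> g y - g z \<le> E"
    using incr by (auto simp: E_def le_max_iff_disj)
  \<comment> \<open>\<open>g\<close> falls by at most \<open>E\<close> per step and vanishes at
    \<open>x\<close>, so reaching \<open>x\<close> takes at least \<open>g y / E\<close> steps.
    Truncation at \<open>n\<close> steps turns this into an induction.\<close>
  have trunc: "ennreal (min (g y) (real n * E)) \<le> ennreal E * (\<Sum>k<n. avoid_prob K x k y)" for n y
  proof (induction n arbitrary: y)
    case 0
    then show ?case using g(1)[of y] by simp
  next
    case (Suc n)
    have "ennreal (min (g y) (real (Suc n) * E)) \<le> ennreal E + ennreal (min (g y - E) (real n * E))"
    proof -
      have eq: "min (g y) (real (Suc n) * E) = E + min (g y - E) (real n * E)"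
        by (simp add: min_def field_simps)
      show ?thesis
      proof (cases "min (g y - E) (real n * E) \<ge> 0")
        case True
        then show ?thesis unfolding eq using E(1) by (subst ennreal_plus) auto
      next
        case False
        then have "ennreal (min (g y) (real (Suc n) * E)) \<le> ennreal E"
          unfolding eq by (intro ennreal_leI) linarith
        then show ?thesis by (simp add: add_increasing2)
      qed
    qed
    also have "ennreal (min (g y - E) (real n * E)) = (\<integral>\<^sup>+z. ennreal (min (g y - E) (real n * E)) \<partial>K y)"
      by simp
    also have "\<dots> \<le> (\<integral>\<^sup>+z. ennreal E * (indicator (- {x}) z * (\<Sum>k<n. avoid_prob K x k z)) \<partial>K y)"
    proof (rule nn_integral_mono_AE, rule AE_pmfI)
      fix z assume "z \<in> set_pmf (K y)"
      then have le: "ennreal (min (g y - E) (real n * E)) \<le> ennreal (min (g z) (real n * E))"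
        using E(2)[of z y] by (intro ennreal_leI) auto
      show "ennreal (min (g y - E) (real n * E)) \<le>
          ennreal E * (indicator (- {x}) z * (\<Sum>k<n. avoid_prob K x k z))"
      proof (cases "z = x")
        case True
        then show ?thesis using le g(2) E(1) by simp
      next
        case False
        then show ?thesis using le Suc[of z] by simp
      qed
    qed
    also have "\<dots> = ennreal E * (\<integral>\<^sup>+z. indicator (- {x}) z * (\<Sum>k<n. avoid_prob K x k z) \<partial>K y)"
      by (rule nn_integral_cmult) simp
    finally show ?case unfolding sum_avoid_prob_step by (simp add: distrib_left add_left_mono)
  qed
  define h where "h n y = (\<Sum>k. avoid_prob K x (k + n) y)" for n y
  have "ennreal (g y) \<le> ennreal E * h 0 y" for y
  proof -
    obtain n :: nat where "g y / E \<le> real n" using real_arch_simple by blast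
    then have "min (g y) (real n * E) = g y" using E(1) by (simp add: field_simps)
    then have "ennreal (g y) \<le> ennreal E * (\<Sum>k<n. avoid_prob K x k y)" using trunc[of y n] by simp
    also have "\<dots> \<le> ennreal E * h 0 y"
      unfolding h_def by (intro mult_left_mono) (auto intro!: sum_le_suminf)
    finally show ?thesis .
  qed
  then have tail: "ennreal (g y) \<le> ennreal E * h n y" for n y
  proof (induction n arbitrary: y)
    case (Suc n)
    have "ennreal (g y) \<le> (\<integral>\<^sup>+z. ennreal (g z) \<partial>K y)" by (rule sub)
    \<comment> \<open>Since \<open>g x = 0\<close>, discarding the transitions into \<open>x\<close>
      costs nothing.\<close>
    also have "\<dots> \<le> (\<integral>\<^sup>+z. ennreal E * (indicator (- {x}) z * h n z) \<partial>K y)"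
      using Suc g(2) by (intro nn_integral_mono) (auto simp: indicator_def)
    also have "\<dots> = ennreal E * (\<integral>\<^sup>+z. indicator (- {x}) z * h n z \<partial>K y)"
      by (rule nn_integral_cmult) simp
    also have "(\<integral>\<^sup>+z. indicator (- {x}) z * h n z \<partial>K y) = h (Suc n) y"
      unfolding h_def by (simp add: nn_integral_suminf[symmetric])
    finally show ?case .
  qed
  have fin: "(\<Sum>k. avoid_prob K x k y) < \<infinity>" by (rule suminf_avoid_prob_finite[OF irr pos])
  \<comment> \<open>The tail is the full series minus a partial sum, moved to the left; in the limit
    the finite quantity \<open>ennreal E * h 0 y\<close> cancels.\<close>
  have "ennreal (g y) + ennreal E * (\<Sum>k<n. avoid_prob K x k y) \<le> ennreal E * h 0 y" for n
  proof -
    have "ennreal E * h 0 y = ennreal E * h n y + ennreal E * (\<Sum>k<n. avoid_prob K x k y)"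
      unfolding h_def using suminf_offset[of "\<lambda>k. avoid_prob K x k y" n] by (simp add: distrib_left)
    then show ?thesis using tail[of y n] by (simp add: add_right_mono)
  qed
  moreover have "(\<lambda>n. ennreal (g y) + ennreal E * (\<Sum>k<n. avoid_prob K x k y))
      \<longlonglongrightarrow> ennreal (g y) + ennreal E * h 0 y"
    unfolding h_def by (intro tendsto_add tendsto_const ennreal_tendsto_cmult) (auto intro: summable_LIMSEQ)
  ultimately have "ennreal E * h 0 y + ennreal (g y) \<le> ennreal E * h 0 y + 0"
    by (intro LIMSEQ_le_const2) (auto simp: add.commute)
  moreover have "ennreal E * h 0 y \<noteq> \<infinity>"
    using suminf_avoid_prob_finite[OF irr pos, of x y] by (auto simp: h_def ennreal_mult_eq_top_iff)
  ultimately have "ennreal (g y) \<le> 0" by (simp only: ennreal_add_left_cancel_le) simp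
  then show ?thesis using g(1)[of y] by simp
qed

section \<open>The relay chain\<close>

lemma integral_pmf_of_list:
  fixes f :: "'s \<Rightarrow> real"
  assumes "pmf_of_list_wf xs"
  shows "measure_pmf.expectation (pmf_of_list xs) f = (\<Sum>(x, p)\<leftarrow>xs. p * f x)"
proof -
  have "measure_pmf.expectation (pmf_of_list xs) f =
      (\<Sum>x\<in>fst ` set xs. sum_list (map snd (filter (\<lambda>z. fst z = x) xs)) * f x)"
    using set_pmf_of_list[OF assms]
    by (subst integral_measure_pmf[of "fst ` set xs"]) (auto simp: pmf_pmf_of_list[OF assms])
  also have "\<dots> = (\<Sum>(x, p)\<leftarrow>xs. p * f x)"
  proof -
    \<comment> \<open>The index set is generalised to a finite superset, because the set of listed
      points grows with the list.\<close>
    have "(\<Sum>x\<in>S. sum_list (map snd (filter (\<lambda>z. fst z = x) xs)) * f x) = (\<Sum>(x, p)\<leftarrow>xs. p * f x)"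
      if "finite S" "fst ` set xs \<subseteq> S" for S
      using that(2)
    proof (induction xs)
      case (Cons z xs)
      have "(\<Sum>x\<in>S. sum_list (map snd (filter (\<lambda>z. fst z = x) (z # xs))) * f x) =
          (\<Sum>x\<in>S. (if x = fst z then snd z * f x else 0) +
            sum_list (map snd (filter (\<lambda>z. fst z = x) xs)) * f x)"
        by (intro sum.cong) (auto simp: algebra_simps)
      then show ?case using Cons that(1) by (simp add: sum.distrib case_prod_beta)
    qed simp
    then show ?thesis by simp
  qed
  finally show ?thesis .
qed

lemma expectation_relay_kernel:
  fixes f :: "state \<Rightarrow> real"
  assumes "0 \<le> lam" "lam \<le> 1" "0 \<le> a" "a \<le> 1"
  shows "measure_pmf.expectation (relay_kernel lam a (i, j)) f =
    (\<Sum>((i', j'), p)\<leftarrow>jump_table lam a (i, j). p * f (nat (int i + i'), nat (int j + j')))"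
  using pmf_of_list_wf_jump_table[OF assms, of "(i, j)"]
  by (simp add: relay_kernel_def integral_pmf_of_list case_prod_unfold)

text \<open>The identity plus a bounded strictly convex term: increments stay in [0, 1], and second
  differences decay only cubically, hence more slowly than the geometric correction.\<close>

definition convex_weight :: "nat \<Rightarrow> real" where
  "convex_weight s = real s + 1 / (real s + 1)"

lemma convex_weight_diff:
  "convex_weight (Suc s) - convex_weight s = 1 - 1 / ((real s + 1) * (real s + 2))"
proof -
  have "real s + 1 \<noteq> 0" "real s + 2 \<noteq> 0" by linarith+
  then have "1 / (real s + 1) - 1 / (real s + 2) = 1 / ((real s + 1) * (real s + 2))"
    by (simp add: divide_simps)
  then show ?thesis by (simp add: convex_weight_def add.commute)
qed

lemma convex_weight_increments:
  "0 \<le> convex_weight (Suc s) - convex_weight s" "convex_weight (Suc s) - convex_weight s \<le> 1"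
proof -
  have "1 * 1 \<le> (real s + 1) * (real s + 2)" by (rule mult_mono) auto
  then have "1 / ((real s + 1) * (real s + 2)) \<le> 1" "0 \<le> 1 / ((real s + 1) * (real s + 2))" by auto
  then show "0 \<le> convex_weight (Suc s) - convex_weight s" "convex_weight (Suc s) - convex_weight s \<le> 1"
    unfolding convex_weight_diff by linarith+
qed

lemma convex_weight_second_diff:
  "(convex_weight (Suc (Suc s)) - convex_weight (Suc s)) - (convex_weight (Suc s) - convex_weight s) =
     2 / ((real s + 1) * (real s + 2) * (real s + 3))"
  unfolding convex_weight_diff by (simp add: divide_simps) (simp add: algebra_simps)

text \<open>With \<open>p\<close> and \<open>q\<close> the probabilities that the total
  \<open>Suc s\<close> rises or falls, this bounds its drift. Lowering \<open>p\<close> to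
  \<open>q\<close> leaves \<open>q\<close> times a second difference.\<close>

lemma convex_weight_drift:
  assumes "0 \<le> q" "q \<le> p"
  shows "p * (convex_weight (Suc (Suc s)) - convex_weight (Suc s)) -
      q * (convex_weight (Suc s) - convex_weight s) \<ge> q * (2 / ((real s + 1) * (real s + 2) * (real s + 3)))"
  unfolding convex_weight_second_diff[symmetric]
  using mult_right_mono[OF assms(2) convex_weight_increments(1)[of "Suc s"]]
  by (simp add: algebra_simps)

text \<open>The right side is the bound of \<open>convex_weight_drift\<close> at the diagonal state
  \<open>(n, n)\<close>, where \<open>s = 2 * n - 1\<close>.\<close>

lemma exponential_below_cubic:
  assumes "q > (0 :: real)"
  shows "\<exists>N. \<forall>n\<ge>N. (1 / 2) ^ n * B \<le> q * (2 / ((2 * real n) * (2 * real n + 1) * (2 * real n + 2)))"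
proof -
  have "(\<lambda>n. (1 / 2) ^ n * B * ((2 * real n) * (2 * real n + 1) * (2 * real n + 2))) \<longlonglongrightarrow> 0"
    by real_asymp
  then have "\<forall>\<^sub>F n in sequentially. (1 / 2) ^ n * B * ((2 * real n) * (2 * real n + 1) * (2 * real n + 2)) < 2 * q"
    using assms by (intro order_tendstoD) auto
  then have "\<forall>\<^sub>F n in sequentially. (1 / 2) ^ n * B \<le> q * (2 / ((2 * real n) * (2 * real n + 1) * (2 * real n + 2)))"
    using eventually_gt_at_top[of 0]
  proof eventually_elim
    case (elim n)
    let ?d = "(2 * real n) * (2 * real n + 1) * (2 * real n + 2)"
    have "0 < ?d" using elim(2) by auto
    with elim(1) have "(1 / 2) ^ n * B \<le> 2 * q / ?d" by (simp only: pos_le_divide_eq less_imp_le)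
    then show ?case by (simp only: times_divide_eq_right mult.commute)
  qed
  then show ?thesis by (simp add: eventually_sequentially)
qed

section \<open>The relay kernel: support, expectations, irreducibility, mean jumps\<close>

locale relay =
  fixes lam a :: real
  assumes lam: "0 < lam" "lam < 1" and a: "0 < a" "a < 1"
begin

abbreviation "K \<equiv> relay_kernel lam a"

abbreviation "c \<equiv> a * (1 - a)"

lemma c: "0 < c" "c \<le> 1 / 4"
proof -
  show "0 < c" using a by simp
  have "0 \<le> (a - 1 / 2)^2" by simp
  then show "c \<le> 1 / 4" by (simp add: power2_eq_square algebra_simps)
qed

lemma quad: "(1 - a)^2 + a^2 = 1 - 2 * c"
  by (simp add: power2_eq_square algebra_simps)

text \<open>The strict bounds on \<open>lam\<close> and \<open>a\<close> make every listed
  probability positive, so no listed jump drops out of the support.\<close>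

lemma set_relay_kernel:
  "set_pmf (K (i, j)) =
     (\<lambda>((i', j'), p). (nat (int i + i'), nat (int j + j'))) ` set (jump_table lam a (i, j))"
proof -
  have q: "0 < lam * ((1 - a)^2 + a^2)" "0 < (1 - lam) * ((1 - a)^2 + a^2)"
    "0 < lam * a" "0 < lam * (1 - a)" "0 < (1 - lam) * a" "0 < (1 - lam) * (1 - a)"
    "0 < lam * a * (1 - a)" "0 < (1 - lam) * a * (1 - a)" "0 < 1 - lam"
    using c lam a unfolding quad by auto
  have "list_all (\<lambda>z. 0 < snd z) (jump_table lam a (i, j))"
    unfolding jump_table_def Let_def prod.case
    by (simp only: list.pred_inject snd_conv split: if_split)
       (intro conjI impI TrueI; use q in linarith)
  then have "p > 0" if "p \<in> snd ` set (jump_table lam a (i, j))" for p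
    using that by (auto simp: list_all_iff)
  then have "set_pmf (pmf_of_list (jump_table lam a (i, j))) = fst ` set (jump_table lam a (i, j))"
    using lam a by (intro set_pmf_of_list_eq pmf_of_list_wf_jump_table) auto
  then show ?thesis by (simp add: relay_kernel_def image_image case_prod_beta)
qed

lemma expectation_K:
  fixes f :: "state \<Rightarrow> real"
  shows "i > j \<Longrightarrow> j > 0 \<Longrightarrow> measure_pmf.expectation (K (i, j)) f =
      lam * (1 - 2 * c) * f (i, j + 1) + (1 - lam) * c * f (i, j - 1) + (1 - lam) * c * f (i - 1, j)
      + lam * c * f (i - 1, j + 1) + ((1 - lam) * (1 - 2 * c) + lam * c) * f (i, j)"
    and "j > i \<Longrightarrow> i > 0 \<Longrightarrow> measure_pmf.expectation (K (i, j)) f =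
      lam * (1 - 2 * c) * f (i + 1, j) + (1 - lam) * c * f (i, j - 1) + (1 - lam) * c * f (i - 1, j)
      + lam * c * f (i + 1, j - 1) + ((1 - lam) * (1 - 2 * c) + lam * c) * f (i, j)"
    and "i > 0 \<Longrightarrow> measure_pmf.expectation (K (i, 0)) f =
      lam * (1 - 2 * c) * f (i, 1) + (1 - lam) * a * f (i - 1, 0)
      + lam * c * f (i - 1, 1) + ((1 - lam) * (1 - a) + lam * c) * f (i, 0)"
    and "j > 0 \<Longrightarrow> measure_pmf.expectation (K (0, j)) f =
      lam * (1 - 2 * c) * f (1, j) + (1 - lam) * a * f (0, j - 1)
      + lam * c * f (1, j - 1) + ((1 - lam) * (1 - a) + lam * c) * f (0, j)"
    and "i > 0 \<Longrightarrow> measure_pmf.expectation (K (i, i)) f =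
      lam * (1 - 2 * c) / 2 * (f (i + 1, i) + f (i, i + 1))
      + (1 - lam) * c * (f (i, i - 1) + f (i - 1, i))
      + lam * c / 2 * (f (i + 1, i - 1) + f (i - 1, i + 1))
      + ((1 - lam) * (1 - 2 * c) + lam * c) * f (i, i)"
    and "measure_pmf.expectation (K (0, 0)) f =
      lam * (1 - a) / 2 * (f (1, 0) + f (0, 1)) + ((1 - lam) + lam * a) * f (0, 0)"
proof -
  have nat: "nat (1 + int k) = Suc k" "nat (int k + 1) = Suc k" "nat (int k - 1) = k - Suc 0" for k
    by auto
  note E = expectation_relay_kernel[OF less_imp_le less_imp_le less_imp_le less_imp_le, OF lam a]
  show "measure_pmf.expectation (K (i, j)) f =
      lam * (1 - 2 * c) * f (i, j + 1) + (1 - lam) * c * f (i, j - 1) + (1 - lam) * c * f (i - 1, j)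
      + lam * c * f (i - 1, j + 1) + ((1 - lam) * (1 - 2 * c) + lam * c) * f (i, j)"
    if "i > j" "j > 0"
    using that unfolding E jump_table_def Let_def quad by (simp add: nat algebra_simps)
  show "measure_pmf.expectation (K (i, j)) f =
      lam * (1 - 2 * c) * f (i + 1, j) + (1 - lam) * c * f (i, j - 1) + (1 - lam) * c * f (i - 1, j)
      + lam * c * f (i + 1, j - 1) + ((1 - lam) * (1 - 2 * c) + lam * c) * f (i, j)"
    if "j > i" "i > 0"
    using that unfolding E jump_table_def Let_def quad by (simp add: nat algebra_simps)
  show "measure_pmf.expectation (K (i, 0)) f =
      lam * (1 - 2 * c) * f (i, 1) + (1 - lam) * a * f (i - 1, 0)
      + lam * c * f (i - 1, 1) + ((1 - lam) * (1 - a) + lam * c) * f (i, 0)"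
    if "i > 0"
    using that unfolding E jump_table_def Let_def quad by (simp add: nat algebra_simps)
  show "measure_pmf.expectation (K (0, j)) f =
      lam * (1 - 2 * c) * f (1, j) + (1 - lam) * a * f (0, j - 1)
      + lam * c * f (1, j - 1) + ((1 - lam) * (1 - a) + lam * c) * f (0, j)"
    if "j > 0"
    using that unfolding E jump_table_def Let_def quad by (simp add: nat algebra_simps)
  show "measure_pmf.expectation (K (i, i)) f =
      lam * (1 - 2 * c) / 2 * (f (i + 1, i) + f (i, i + 1))
      + (1 - lam) * c * (f (i, i - 1) + f (i - 1, i))
      + lam * c / 2 * (f (i + 1, i - 1) + f (i - 1, i + 1))
      + ((1 - lam) * (1 - 2 * c) + lam * c) * f (i, i)"
    if "i > 0"
    using that unfolding E jump_table_def Let_def quad by (simp add: nat field_simps)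
  show "measure_pmf.expectation (K (0, 0)) f =
      lam * (1 - a) / 2 * (f (1, 0) + f (0, 1)) + ((1 - lam) + lam * a) * f (0, 0)"
    unfolding E jump_table_def Let_def quad by (simp add: nat field_simps)
qed

text \<open>The two relays are exchangeable, so drift estimates for symmetric functions need
  checking only for \<open>j \<le> i\<close>.\<close>

lemma expectation_K_swap:
  fixes f :: "state \<Rightarrow> real"
  assumes "\<And>k l. f (k, l) = f (l, k)"
  shows "measure_pmf.expectation (K (i, j)) f = measure_pmf.expectation (K (j, i)) f"
proof -
  have "measure_pmf.expectation (K (i, j)) f = measure_pmf.expectation (K (j, i)) f" if "j < i" for i j
  proof (cases "j = 0")
    case True
    with that show ?thesis
      using assms[of i 1] assms[of "i - 1" 0] assms[of "i - 1" 1] assms[of i 0]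
      by (simp add: expectation_K)
  next
    case False
    with that show ?thesis
      using assms[of i "j + 1"] assms[of i "j - 1"] assms[of "i - 1" j] assms[of "i - 1" "j + 1"]
        assms[of i j]
      by (simp add: expectation_K)
  qed
  then show ?thesis by (cases i j rule: linorder_cases) auto
qed

lemma finite_set_K: "finite (set_pmf (K s))"
  by (cases s) (simp add: set_relay_kernel)

lemma integrable_K: "integrable (K s) (f :: state \<Rightarrow> real)"
  by (rule integrable_measure_pmf_finite[OF finite_set_K])

lemma nn_integral_K:
  fixes f :: "state \<Rightarrow> real"
  assumes "\<And>s. f s \<ge> 0"
  shows "(\<integral>\<^sup>+t. ennreal (f t) \<partial>K s) = ennreal (measure_pmf.expectation (K s) f)"
  using assms by (intro nn_integral_eq_integral integrable_K) auto

lemma steps_K: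
  shows "j > 0 \<Longrightarrow> (i, j - 1) \<in> set_pmf (K (i, j))"
    and "i > 0 \<Longrightarrow> (i - 1, j) \<in> set_pmf (K (i, j))"
    and "(i + 1, i) \<in> set_pmf (K (i, i))"
    and "i > j \<Longrightarrow> (i, j + 1) \<in> set_pmf (K (i, j))"
    and "(i, j) \<in> set_pmf (K (i, j))"
  unfolding set_relay_kernel by (auto simp: jump_table_def Let_def image_iff nat_add_distrib)

text \<open>Arrivals join the shorter queue, so the chain can grow only along the diagonal: it
  empties, climbs the staircase to \<open>(k + l, k + l)\<close>, and descends to
  \<open>(k, l)\<close> by departures.\<close>

lemma irreducible_K: "irreducible_chain K"
proof (rule irreducible_chainI)
  fix x y :: state
  let ?R = "{(x, y). y \<in> set_pmf (K x)}"
  have dec2: "((i, j + k), (i, j)) \<in> ?R\<^sup>*" for i j k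
  proof (induction k)
    case (Suc k)
    then show ?case using steps_K(1)[of "j + Suc k" i]
      by (auto intro: converse_rtrancl_into_rtrancl)
  qed simp
  have dec1: "((i + k, j), (i, j)) \<in> ?R\<^sup>*" for i j k
  proof (induction k)
    case (Suc k)
    then show ?case using steps_K(2)[of "i + Suc k" j]
      by (auto intro: converse_rtrancl_into_rtrancl)
  qed simp
  have dec: "((i + k, j + l), (i, j)) \<in> ?R\<^sup>*" for i j k l
    using dec2[of "i + k" j l] dec1[of i k j] by (rule rtrancl_trans)
  have diag: "((0, 0), (n, n)) \<in> ?R\<^sup>*" for n
  proof (induction n)
    case (Suc n)
    have "((n, n), (n + 1, n)) \<in> ?R" "((n + 1, n), (n + 1, n + 1)) \<in> ?R"
      using steps_K(3)[of n] steps_K(4)[of n "n + 1"] by auto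
    with Suc show ?case by (auto intro: rtrancl_into_rtrancl)
  qed simp
  obtain i j k l where x: "x = (i, j)" and y: "y = (k, l)" by (cases x, cases y)
  have "((i, j), (0, 0)) \<in> ?R\<^sup>*" using dec[of 0 i 0 j] by simp
  moreover have "((k + l, k + l), (k, l)) \<in> ?R\<^sup>*" using dec[of k l l k] by (simp add: add.commute)
  ultimately show "(x, y) \<in> ?R\<^sup>*" using diag[of "k + l"] unfolding x y by (meson rtrancl_trans)
qed

lemma aperiodic_K: "aperiodic_chain K"
  unfolding aperiodic_chain_def
proof
  fix x :: state
  have "pmf (n_step K 1 x) x > 0"
    using steps_K(5)[of "fst x" "snd x"] by (simp add: bind_return_pmf' pmf_positive)
  then have "1 \<in> {n. n > 0 \<and> pmf (n_step K n x) x > 0}" by simp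
  then have "Gcd {n. n > 0 \<and> pmf (n_step K n x) x > 0} dvd 1" by (rule Gcd_dvd)
  then show "Gcd {n. n > 0 \<and> pmf (n_step K n x) x > 0} = 1" by simp
qed

lemma mean_jump_H:
  assumes "s \<in> region_H"
  shows "mean_jump K s = (- c, lam - c)"
proof -
  obtain i j where s: "s = (i, j)" "i > j" "j > 0" using assms by (auto simp: region_H_def)
  then have "real (i - 1) = real i - 1" "real (j - 1) = real j - 1" by auto
  with s show ?thesis by (simp add: mean_jump_def expectation_K algebra_simps)
qed

lemma mean_jump_V:
  assumes "s \<in> region_V"
  shows "mean_jump K s = (lam - c, - c)"
proof -
  obtain i j where s: "s = (i, j)" "j > i" "i > 0" using assms by (auto simp: region_V_def)
  then have "real (i - 1) = real i - 1" "real (j - 1) = real j - 1" by auto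
  with s show ?thesis by (simp add: mean_jump_def expectation_K algebra_simps)
qed

section \<open>Stability for \<open>lam < 2 * c\<close>\<close>

lemma quadratic_drift:
  fixes \<delta> :: real and f :: "state \<Rightarrow> real"
  assumes \<delta>: "\<delta> \<le> c" "\<delta> \<le> 2 * c - lam"
  defines "f \<equiv> \<lambda>(i, j). (real i)^2 + (real j)^2"
  shows "measure_pmf.expectation (K (i, j)) f \<le> f (i, j) - 2 * \<delta> * real (max i j) + 2"
proof -
  have lc: "0 \<le> lam * c" "lam * c \<le> lam" "lam * c \<le> c"
    using lam c mult_mono[of lam lam c 1] mult_mono[of lam 1 c c] by auto
  \<comment> \<open>The drift is twice the inner product of state and mean jump plus the mean
    squared jump length; the latter is at most 2.\<close>
  have main: "measure_pmf.expectation (K (i, j)) f \<le> f (i, j) - 2 * \<delta> * real i + 2" if le: "j \<le> i" for i j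
  proof -
    consider "i = 0" "j = 0" | "i > 0" "j = 0" | "i > 0" "i = j" | "i > j" "j > 0"
      using le by (cases i j rule: linorder_cases; cases "j = 0") auto
    then show ?thesis
    proof cases
      case 1
      have "lam * (1 - a) \<le> 1 * 1" using lam a by (intro mult_mono) auto
      with 1 show ?thesis by (simp add: expectation_K f_def)
    next
      case 2
      then have r: "real (i - 1) = real i - 1" by auto
      have "measure_pmf.expectation (K (i, j)) f - f (i, j) =
          - 2 * (a - lam * a + lam * c) * real i + (lam * (1 - 2 * c) + (1 - lam) * a + 2 * lam * c)"
        unfolding 2(2) expectation_K(3)[OF 2(1)] f_def
        by (simp add: r[simplified] power2_eq_square algebra_simps)
      \<comment> \<open>Without an arrival a lone non-empty relay meets no collision and succeeds
        with probability \<open>a\<close>, which exceeds \<open>c\<close>.\<close>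
      moreover have "\<delta> * real i \<le> (a - lam * a + lam * c) * real i"
      proof (rule mult_right_mono)
        have "(1 - lam) * c \<le> (1 - lam) * a" using lam a by (intro mult_left_mono) auto
        then show "\<delta> \<le> a - lam * a + lam * c" using \<delta>(1) by (simp add: algebra_simps)
      qed simp
      moreover have "(1 - lam) * a \<le> (1 - lam) * 1" using lam a by (intro mult_left_mono) auto
      ultimately show ?thesis using lam by (simp add: algebra_simps)
    next
      case 3
      then have r: "real (i - 1) = real i - 1" by auto
      have "measure_pmf.expectation (K (i, j)) f - f (i, j) =
          - 2 * (2 * c - lam) * real i + (lam * (1 - 2 * c) + 2 * c)"
        unfolding 3(2)[symmetric] expectation_K(5)[OF 3(1)] f_def
        by (simp add: r[simplified] power2_eq_square field_simps)
      moreover have "\<delta> * real i \<le> (2 * c - lam) * real i"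
        using \<delta>(2) by (intro mult_right_mono) auto
      ultimately show ?thesis using lam c lc by (simp add: algebra_simps)
    next
      case 4
      then have r: "real (i - 1) = real i - 1" "real (j - 1) = real j - 1" by auto
      have "measure_pmf.expectation (K (i, j)) f - f (i, j) =
          2 * ((lam - c) * real j - c * real i) + (lam * (1 - 2 * c) + 2 * c)"
        unfolding expectation_K(1)[OF 4] f_def
        by (simp add: r[simplified] power2_eq_square algebra_simps)
      \<comment> \<open>Linear in \<open>j\<close>, hence largest at an end of [0, i]:
        \<open>- c * i\<close> at \<open>j = 0\<close>, \<open>- (2 * c - lam) * i\<close> at
        \<open>j = i\<close>.\<close>
      moreover have "(lam - c) * real j - c * real i \<le> - \<delta> * real i"
      proof (cases "lam \<le> c")
        case True
        then have "(lam - c) * real j \<le> 0" by (simp add: mult_nonpos_nonneg)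
        moreover have "\<delta> * real i \<le> c * real i" using \<delta>(1) by (intro mult_right_mono) auto
        ultimately show ?thesis by simp
      next
        case False
        then have "(lam - c) * real j \<le> (lam - c) * real i" using 4 by (intro mult_left_mono) auto
        moreover have "\<delta> * real i \<le> (2 * c - lam) * real i"
          using \<delta>(2) by (intro mult_right_mono) auto
        ultimately show ?thesis by (simp add: algebra_simps)
      qed
      ultimately show ?thesis using lam c lc by (simp add: algebra_simps)
    qed
  qed
  show ?thesis
  proof (cases "j \<le> i")
    case True
    then show ?thesis using main[of j i] by (simp add: max_def)
  next
    case False
    have "measure_pmf.expectation (K (i, j)) f = measure_pmf.expectation (K (j, i)) f"
      by (rule expectation_K_swap) (simp add: f_def)
    moreover have "f (i, j) = f (j, i)" by (simp add: f_def)
    ultimately show ?thesis using False main[of i j] by (simp add: max_def)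
  qed
qed

lemma positive_recurrent_K:
  assumes "lam < 2 * c"
  shows "positive_recurrent K"
proof -
  define \<delta> where "\<delta> = min c (2 * c - lam)"
  have \<delta>: "\<delta> > 0" "\<delta> \<le> c" "\<delta> \<le> 2 * c - lam" using assms c by (auto simp: \<delta>_def)
  \<comment> \<open>Outside the box the drift is at most 2 - 3 = -1; inside it is at most 2, so
    \<open>b = 3\<close> absorbs it together with the required 1.\<close>
  obtain N :: nat where N: "3 / (2 * \<delta>) \<le> real N" using real_arch_simple by blast
  define f :: "state \<Rightarrow> real" where "f = (\<lambda>(i, j). (real i)^2 + (real j)^2)"
  have f: "f s \<ge> 0" for s by (cases s) (simp add: f_def)
  let ?A = "{..N} \<times> {..N}"
  show ?thesis
  proof (rule foster_positive_recurrent[OF irreducible_K, where A = ?A and V = "\<lambda>s. ennreal (f s)" and b = 3])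
    fix s :: state
    obtain i j where s: "s = (i, j)" by (cases s)
    have d: "measure_pmf.expectation (K s) f \<le> f s - 2 * \<delta> * real (max i j) + 2"
      using quadratic_drift[OF \<delta>(2,3), of i j] by (simp add: s f_def)
    have "1 + measure_pmf.expectation (K s) f \<le> f s + 3 * indicator ?A s"
    proof (cases "s \<in> ?A")
      case True
      have "0 \<le> \<delta> * real (max i j)" using \<delta> by simp
      with d True show ?thesis by simp
    next
      case False
      then have "real N \<le> real (max i j)" by (auto simp: s)
      then have "3 / (2 * \<delta>) \<le> real (max i j)" using N by linarith
      then have "3 \<le> 2 * \<delta> * real (max i j)" using \<delta>(1) by (simp add: field_simps)
      with d False show ?thesis by simp
    qed
    then have "ennreal (1 + measure_pmf.expectation (K s) f) \<le> ennreal (f s + 3 * indicator ?A s)"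
      by (rule ennreal_leI)
    moreover have "measure_pmf.expectation (K s) f \<ge> 0" using f by (intro integral_nonneg_AE) auto
    ultimately show "1 + (\<integral>\<^sup>+t. ennreal (f t) \<partial>K s) \<le> ennreal (f s) + 3 * indicator ?A s"
      using f by (cases "s \<in> ?A") (simp_all add: nn_integral_K)
  qed auto
qed

section \<open>Instability for \<open>2 * c \<le> lam\<close>\<close>

definition axis_weight :: real where
  "axis_weight = 2 / (lam * (1 - c))"

text \<open>
  For \<open>a > 1/2\<close> the drift of \<open>i + j\<close> is negative on the axes when \<open>lam\<close> is near \<open>2 * c\<close>; the bounded
  second term compensates this. Off the axes it is a submartingale except on the diagonal, where its
  loss is exponentially small and is outweighed by the strict convexity of \<open>convex_weight\<close>.
  The latter is needed at \<open>lam = 2 * c\<close>, where \<open>i + j\<close> has no drift on the diagonal.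
\<close>

definition test_fun :: "state \<Rightarrow> real" where
  "test_fun = (\<lambda>(i, j). convex_weight (i + j) - axis_weight * (1 / 2) ^ min i j)"

text \<open>The normalisation fits the axes: from \<open>(i, 0)\<close> with
  \<open>i \<ge> 2\<close>, \<open>min i j\<close> rises to 1 with probability
  \<open>lam * (1 - c)\<close>. The resulting mean gain,
  \<open>lam * (1 - c) * axis_weight / 2 = 1\<close>, covers the loss of at most 1 from
  departures.\<close>

lemma axis_weight: "axis_weight > 0" "lam * (1 - c) * axis_weight = 2"
  using lam c by (auto simp: axis_weight_def)

lemma test_fun_drift:
  assumes "2 * c \<le> lam"
  shows "\<exists>N. \<forall>i j. i + j \<ge> N \<longrightarrow> test_fun (i, j) \<le> measure_pmf.expectation (K (i, j)) test_fun"
proof -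
  define p where "p = lam * (1 - 2 * c)"
  define q where "q = (1 - lam) * c"
  have q: "q > 0" using lam c by (simp add: q_def)
  \<comment> \<open>In fact \<open>p - 2 * q = lam - 2 * c\<close>.\<close>
  have pq: "2 * q \<le> p" using assms by (simp add: p_def q_def algebra_simps)
  let ?F = convex_weight and ?B = axis_weight
  obtain N where N: "\<And>n. n \<ge> N \<Longrightarrow>
      (1 / 2) ^ n * (?B * (2 * q + lam * c)) \<le> 2 * q * (2 / ((2 * real n) * (2 * real n + 1) * (2 * real n + 2)))"
    using exponential_below_cubic[of "2 * q" "?B * (2 * q + lam * c)"] q by auto
  have main: "test_fun (i, j) \<le> measure_pmf.expectation (K (i, j)) test_fun"
    \<comment> \<open>The bound gives \<open>i \<ge> 2\<close> on the axis, so that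
      \<open>(i - 1, 1)\<close> has minimum 1, and \<open>i \<ge> N\<close> on the diagonal.\<close>
    if le: "j \<le> i" and large: "i + j \<ge> 2 * N + 2" for i j
  proof -
    consider "j = 0" | "i = j" "j > 0" | "i > j" "j > 0"
      using le by (cases i j rule: linorder_cases; cases "j = 0") auto
    then show ?thesis
    proof cases
      case 1
      obtain k where i: "i = Suc (Suc k)" using large 1 by (cases i; cases "i - 1") auto
      have "measure_pmf.expectation (K (i, j)) test_fun - test_fun (i, j) =
          p * (?F (Suc i) - ?F i) - (1 - lam) * a * (?F i - ?F (Suc k)) + lam * (1 - c) * ?B / 2"
        unfolding 1 i expectation_K(3)[OF zero_less_Suc]
        by (simp add: test_fun_def p_def field_simps)
      moreover have "0 \<le> p * (?F (Suc i) - ?F i)"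
        using pq q convex_weight_increments(1)[of i] by simp
      moreover have "(1 - lam) * a * (?F i - ?F (Suc k)) \<le> 1 * 1 * 1"
        using lam a convex_weight_increments[of "Suc k"] unfolding i by (intro mult_mono) auto
      ultimately show ?thesis using axis_weight(2) by simp
    next
      case 2
      then obtain k where i: "i = Suc k" by (cases i) auto
      \<comment> \<open>From the diagonal the minimum never rises; it drops with probability
        \<open>2 * q + lam * c\<close>, each time at the cost
        \<open>(1 / 2) ^ i * axis_weight\<close>.\<close>
      have "measure_pmf.expectation (K (i, j)) test_fun - test_fun (i, j) =
          p * (?F (Suc (i + i)) - ?F (i + i)) - 2 * q * (?F (i + i) - ?F (Suc (k + k)))
          - (1 / 2) ^ i * (?B * (2 * q + lam * c))"
        unfolding 2(1)[symmetric] i expectation_K(5)[OF zero_less_Suc]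
        by (simp add: test_fun_def p_def q_def field_simps)
      moreover have "p * (?F (Suc (i + i)) - ?F (i + i)) - 2 * q * (?F (i + i) - ?F (Suc (k + k))) \<ge>
          2 * q * (2 / ((2 * real i) * (2 * real i + 1) * (2 * real i + 2)))"
        using convex_weight_drift[of "2 * q" p "Suc (k + k)"] pq q by (simp add: i algebra_simps)
      moreover have "N \<le> i" using large 2 by simp
      ultimately show ?thesis using N[of i] by linarith
    next
      case 3
      then obtain k where j: "j = Suc k" by (cases j) auto
      obtain l where i: "i = Suc (Suc (k + l))" using 3 j less_imp_Suc_add[of j i] by auto
      \<comment> \<open>For the jump to \<open>(i - 1, j + 1)\<close>: the minimum stays
        \<open>j\<close> if \<open>i = j + 1\<close> (\<open>l = 0\<close>) and becomes
        \<open>j + 1\<close> otherwise.\<close>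
      have m: "min (k + l) (Suc k) = k + min l (Suc 0)" by (simp add: min_def)
      have "measure_pmf.expectation (K (i, j)) test_fun - test_fun (i, j) =
          p * (?F (Suc (i + j)) - ?F (i + j)) - 2 * q * (?F (i + j) - ?F (i + k))
          + ?B * (1 / 2) ^ j * (p / 2 - q) + lam * c * ?B * ((1 / 2) ^ j - (1 / 2) ^ Suc (k + min l 1))"
        unfolding i j expectation_K(1)[of "Suc k" "Suc (Suc (k + l))", simplified]
        by (simp add: test_fun_def p_def q_def m field_simps)
      moreover have "p * (?F (Suc (i + j)) - ?F (i + j)) - 2 * q * (?F (i + j) - ?F (i + k)) \<ge>
          2 * q * (2 / ((real (i + k) + 1) * (real (i + k) + 2) * (real (i + k) + 3)))"
        using convex_weight_drift[of "2 * q" p "i + k"] pq q by (simp add: j)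
      moreover have "0 \<le> 2 * q * (2 / ((real (i + k) + 1) * (real (i + k) + 2) * (real (i + k) + 3)))"
        using q by simp
      moreover have "0 \<le> ?B * (1 / 2) ^ j * (p / 2 - q)" using axis_weight(1) pq by simp
      moreover have "0 \<le> lam * c * ?B * ((1 / 2) ^ j - (1 / 2) ^ Suc (k + min l 1))"
        using axis_weight(1) lam a unfolding j
        by (intro mult_nonneg_nonneg) (auto intro!: power_decreasing)
      ultimately show ?thesis by linarith
    qed
  qed
  show ?thesis
  proof (intro exI[of _ "2 * N + 2"] allI impI)
    fix i j assume ij: "2 * N + 2 \<le> i + j"
    show "test_fun (i, j) \<le> measure_pmf.expectation (K (i, j)) test_fun"
    proof (cases "j \<le> i")
      case True
      then show ?thesis using main[of j i] ij by simp
    next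
      case False
      have sym: "test_fun (k, l) = test_fun (l, k)" for k l
        by (simp add: test_fun_def add.commute min.commute)
      have "measure_pmf.expectation (K (i, j)) test_fun = measure_pmf.expectation (K (j, i)) test_fun"
        by (rule expectation_K_swap) (rule sym)
      then show ?thesis using False main[of i j] ij sym[of i j] by simp
    qed
  qed
qed

lemma not_positive_recurrent_K:
  assumes "2 * c \<le> lam"
  shows "\<not> positive_recurrent K"
proof
  assume pos: "positive_recurrent K"
  obtain N where N: "\<And>i j. i + j \<ge> N \<Longrightarrow> test_fun (i, j) \<le> measure_pmf.expectation (K (i, j)) test_fun"
    using test_fun_drift[OF assms] by blast
  have weight: "real s \<le> convex_weight s" "convex_weight s \<le> real s + 1" for s
    by (auto simp: convex_weight_def field_simps)
  have pow: "0 \<le> axis_weight * (1 / 2) ^ n" "axis_weight * (1 / 2) ^ n \<le> axis_weight" for n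
    using axis_weight(1) by (auto simp: mult_le_cancel_left1 power_le_one)
  have bounds: "real (i + j) - axis_weight \<le> test_fun (i, j)" "test_fun (i, j) \<le> real (i + j) + 1" for i j
    using weight[of "i + j"] pow[of "min i j"] by (auto simp: test_fun_def)
  \<comment> \<open>As \<open>test_fun\<close> is at most \<open>i + j + 1\<close>, this level makes
    \<open>g\<close> vanish for \<open>i + j \<le> N\<close>, which contains all states where the
    drift inequality may fail.\<close>
  define g where "g s = max 0 (test_fun s - (real N + 1))" for s
  have "g y = 0" for y
  \<comment> \<open>The total falls by at most one per step, costing at most 1 in
    \<open>convex_weight\<close>; the geometric term ranges over an interval of length
    \<open>axis_weight\<close>.\<close>
  proof (rule bounded_submartingale_zero[OF irreducible_K pos, where x = "(0, 0)" and D = "1 + axis_weight"])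
    show "g s \<ge> 0" for s by (simp add: g_def)
    show "g (0, 0) = 0" using bounds(2)[of 0 0] by (simp add: g_def)
    show "g y - g z \<le> 1 + axis_weight" if "z \<in> set_pmf (K y)" for y z
    proof -
      obtain i j k l where y: "y = (i, j)" and z: "z = (k, l)" by (cases y, cases z)
      have "i + j \<le> Suc (k + l)"
        using that unfolding y z set_relay_kernel
        by (auto simp: jump_table_def Let_def split: if_splits)
      then have "i + j \<le> k + l \<or> i + j = Suc (k + l)" by linarith
      moreover have "convex_weight m \<le> convex_weight n" if "m \<le> n" for m n
        using lift_Suc_mono_le[of convex_weight m n] convex_weight_increments(1) that by simp
      ultimately have "convex_weight (i + j) - convex_weight (k + l) \<le> 1"
        using convex_weight_increments(2)[of "k + l"] by fastforce
      then have "test_fun y - test_fun z \<le> 1 + axis_weight"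
        using pow[of "min i j"] pow[of "min k l"]
        unfolding y z test_fun_def prod.case by linarith
      then show ?thesis using axis_weight(1) by (simp add: g_def max_def)
    qed
    show "ennreal (g y) \<le> (\<integral>\<^sup>+z. ennreal (g z) \<partial>K y)" for y
    proof -
      obtain i j where y: "y = (i, j)" by (cases y)
      have "g y \<le> measure_pmf.expectation (K y) g"
      proof (cases "i + j \<ge> N")
        case True
        have "measure_pmf.expectation (K y) test_fun - (real N + 1) =
            measure_pmf.expectation (K y) (\<lambda>z. test_fun z - (real N + 1))"
          by (subst Bochner_Integration.integral_diff) (auto simp: integrable_K)
        also have "\<dots> \<le> measure_pmf.expectation (K y) g"
          by (intro integral_mono integrable_K) (simp add: g_def)
        finally have "test_fun y - (real N + 1) \<le> measure_pmf.expectation (K y) g"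
          using N[OF True] by (simp add: y)
        moreover have "0 \<le> measure_pmf.expectation (K y) g"
          by (intro integral_nonneg_AE) (simp add: g_def)
        ultimately show ?thesis by (simp add: g_def)
      next
        case False
        then have "g y = 0" using bounds(2)[of i j] by (simp add: g_def y)
        also have "0 \<le> measure_pmf.expectation (K y) g"
          by (intro integral_nonneg_AE) (simp add: g_def)
        finally show ?thesis .
      qed
      then show ?thesis by (subst nn_integral_K) (auto simp: g_def intro: ennreal_leI)
    qed
  qed
  then have "g (n, 0) = 0" for n .
  moreover obtain n :: nat where "real N + 1 + axis_weight < real n" using reals_Archimedean2 by blast
  ultimately show False using bounds(1)[of n 0] by (simp add: g_def max_def split: if_splits) (smt (verit))
qed

end

theorem theorem2p3:
  fixes lam a :: real
  assumes "0 < lam" "lam < 1" "0 < a" "a < 1"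
  shows "\<exists>ExH EyH ExV EyV :: real.
    (\<forall>s\<in>region_H. mean_jump (relay_kernel lam a) s = (ExH, EyH)) \<and>
    (\<forall>s\<in>region_V. mean_jump (relay_kernel lam a) s = (ExV, EyV)) \<and>
    ExH + EyH = ExV + EyV \<and> ExV + EyV = lam - 2 * a * (1 - a) \<and>
    (ergodic_chain (relay_kernel lam a) \<longleftrightarrow> positive_recurrent (relay_kernel lam a)) \<and>
    (ergodic_chain (relay_kernel lam a) \<longleftrightarrow>
      ExH < 0 \<and> EyV < 0 \<and>
      ExH + EyH = ExV + EyV \<and> ExV + EyV = lam - 2 * a * (1 - a) \<and> lam - 2 * a * (1 - a) < 0) \<and>
    (ergodic_chain (relay_kernel lam a) \<longleftrightarrow>
      lam * ((1 - a)^2 + a^2) / (2 * (1 - lam) * (1 - a) * a) < 1)"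
proof -
  interpret relay lam a by unfold_locales (use assms in auto)
  have erg: "ergodic_chain K \<longleftrightarrow> positive_recurrent K"
    by (simp add: ergodic_chain_def irreducible_K aperiodic_K)
  have pos: "positive_recurrent K \<longleftrightarrow> lam < 2 * c"
    using positive_recurrent_K not_positive_recurrent_K by (cases "lam < 2 * c") auto
  have "0 < 2 * (1 - lam) * (1 - a) * a" using assms by simp
  \<comment> \<open>After clearing the denominator, \<open>2 * lam * c\<close> cancels from
    \<open>lam * (1 - 2 * c) < 2 * (1 - lam) * c\<close>.\<close>
  then have rho: "lam * ((1 - a)^2 + a^2) / (2 * (1 - lam) * (1 - a) * a) < 1 \<longleftrightarrow> lam < 2 * c"
    unfolding quad by (simp add: divide_less_eq algebra_simps)
  show ?thesis
    unfolding erg pos rho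
    by (rule exI[of _ "- c"], rule exI[of _ "lam - c"], rule exI[of _ "lam - c"], rule exI[of _ "- c"])
       (use mean_jump_H mean_jump_V c(1) in \<open>simp add: mult.assoc\<close>)
qed

end
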